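(* Let $K$ be a compact space with the finitely supported Josefson--Nissenzweig property. Then either there is an fsJN-sequence $\langle\mu_n\colon n\in\omega\rangle$ of measures on $K$ such that for every $n\in\omega$ the measure $\mu_n$ is of the form $\mu_n=\frac12(\delta_{x_n}-\delta_{y_n})$, where $x_n,y_n\in K$, or every fsJN-sequence $\langle\mu_n\colon n\in\omega\rangle$ on $K$ satisfies $\lim_{n\to\infty}|\mathrm{supp}(\mu_n)|=\infty$.
   Context: All compact spaces are Hausdorff. A measure on $K$ is a signed $\sigma$-additive Radon measure on the Borel $\sigma$-algebra of $K$; $\|\mu\|$ denotes its total variation norm and $\mathrm{supp}(\mu)$ its support; $\delta_x$ is the Dirac measure at $x$. An fsJN-sequence on $K$ is a sequence $\langle\mu_n\colon n\in\omega\rangle$ of finitely supported measures on $K$ with $\|\mu_n\|=1$ for every $n\in\omega$ and $\lim_{n\to\infty}\int_K f\,d\mu_n=0$ for every continuous $f\colon K\to\mathbb{R}$. $K$ has the finitely supported Josefson--Nissenzweig property (fsJNP) if it admits an fsJN-sequence. *)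

theory Defs
  imports "HOL-Probability.Probability"
begin

text \<open>A signed measure on the Borel sets of the space \<open>'a\<close> is a real-valued set function.
  As with \<^const>\<open>emeasure\<close>, its value outside the \<open>\<sigma>\<close>-algebra is fixed to be 0, so that
  equality of measures is equality of functions.  The condition \<open>\<mu> {} = 0\<close> follows from
  \<open>\<sigma>\<close>-additivity, as the series \<open>\<mu> {} + \<mu> {} + \<dots>\<close> has to converge.\<close>

definition signed_measure :: "('a::topological_space set \<Rightarrow> real) \<Rightarrow> bool" where
  "signed_measure \<mu> \<longleftrightarrow>
     (\<forall>A. A \<notin> sets borel \<longrightarrow> \<mu> A = 0) \<and>
     (\<forall>A :: nat \<Rightarrow> 'a set. range A \<subseteq> sets borel \<longrightarrow> disjoint_family A \<longrightarrow>
        (\<lambda>n. \<mu> (A n)) sums \<mu> (\<Union>n. A n))"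

definition variation :: "('a::topological_space set \<Rightarrow> real) \<Rightarrow> 'a set \<Rightarrow> ennreal" where
  "variation \<mu> A =
     (SUP P \<in> {P. finite P \<and> P \<subseteq> sets borel \<and> partition_on A P}. \<Sum>B\<in>P. ennreal \<bar>\<mu> B\<bar>)"

definition tv_norm :: "('a::topological_space set \<Rightarrow> real) \<Rightarrow> ennreal" where
  "tv_norm \<mu> = variation \<mu> UNIV"

text \<open>Signed measures are finite, so for them being Radon is inner regularity of the
  variation with respect to compact sets.\<close>

definition radon_measure :: "('a::t2_space set \<Rightarrow> real) \<Rightarrow> bool" where
  "radon_measure \<mu> \<longleftrightarrow> signed_measure \<mu> \<and>
     (\<forall>A \<in> sets borel. variation \<mu> A = (SUP C \<in> {C. compact C \<and> C \<subseteq> A}. variation \<mu> C))"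

definition supp :: "('a::topological_space set \<Rightarrow> real) \<Rightarrow> 'a set" where
  "supp \<mu> = {x. \<forall>U. open U \<longrightarrow> x \<in> U \<longrightarrow> variation \<mu> U \<noteq> 0}"

text \<open>The positive part of the Jordan decomposition.  Negative values \<open>\<mu> B\<close> are cut off at 0
  by \<^const>\<open>ennreal\<close>, which is harmless since \<open>B = {}\<close> contributes 0 to the supremum.\<close>

definition positive_part :: "('a::topological_space set \<Rightarrow> real) \<Rightarrow> 'a measure" where
  "positive_part \<mu> = measure_of UNIV (sets borel)
     (\<lambda>A. SUP B \<in> {B \<in> sets borel. B \<subseteq> A}. ennreal (\<mu> B))"

definition negative_part :: "('a::topological_space set \<Rightarrow> real) \<Rightarrow> 'a measure" where
  "negative_part \<mu> = positive_part (\<lambda>A. - \<mu> A)"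

definition signed_integral :: "('a::topological_space set \<Rightarrow> real) \<Rightarrow> ('a \<Rightarrow> real) \<Rightarrow> real" where
  "signed_integral \<mu> f = integral\<^sup>L (positive_part \<mu>) f - integral\<^sup>L (negative_part \<mu>) f"

definition dirac :: "'a::topological_space \<Rightarrow> 'a set \<Rightarrow> real" where
  "dirac x = measure (return borel x)"

definition fsJN_sequence :: "(nat \<Rightarrow> 'a::t2_space set \<Rightarrow> real) \<Rightarrow> bool" where
  "fsJN_sequence \<mu> \<longleftrightarrow>
     (\<forall>n. radon_measure (\<mu> n) \<and> finite (supp (\<mu> n)) \<and> tv_norm (\<mu> n) = 1) \<and>
     (\<forall>f. continuous_on UNIV f \<longrightarrow> (\<lambda>n. signed_integral (\<mu> n) f) \<longlonglongrightarrow> 0)"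

definition fsJNP :: "'a::t2_space itself \<Rightarrow> bool" where
  "fsJNP K \<longleftrightarrow> (\<exists>\<mu> :: nat \<Rightarrow> 'a set \<Rightarrow> real. fsJN_sequence \<mu>)"

end

theory Submission
  imports Defs
begin

text \<open>Suppose that the sizes of the supports of some fsJN-sequence do not tend to infinity, so that
  they are below some \<open>M\<close> infinitely often.  A finitely supported Radon measure is the sum of its
  atoms (\<open>radon_measure_finite_supp_atomic\<close>), so integrals against it are finite sums and its norm
  is the sum of the absolute masses (\<open>signed_integral_atomic\<close>, \<open>variation_atomic\<close>).  By
  the pigeonhole principle one may enumerate the supports along a subsequence as
  \<open>x n 0, \<dots>, x n (m - 1)\<close> with \<open>m\<close> constant, such that for one fixed index \<open>k\<close> the mass
  at \<open>x n k\<close> has absolute value at least \<open>1 / M\<close>.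

  Say that \<open>x _ j\<close> merges with \<open>x _ k\<close> along a subsequence if
  \<open>f (x n k) - f (x n j)\<close> tends to 0 along it for every continuous \<open>f\<close>.  If this happens for some
  \<open>j \<noteq> k\<close>, then, along that subsequence, the measures with mass \<open>1/2\<close> at \<open>x n k\<close> and \<open>-1/2\<close> at \<open>x n j\<close> form an
  fsJN-sequence (\<open>merging_points_fsJN_sequence\<close>), and these have the required form.

  Otherwise every \<open>j \<noteq> k\<close> is separated from \<open>k\<close> by some continuous function on a subsequence of
  any given subsequence.  Treating the finitely many \<open>j\<close> one after another and multiplying the
  separating functions, each shifted by a suitable constant, yields a single continuous \<open>h\<close> and a subsequence on which
  \<open>\<bar>h (x n k)\<bar>\<close> stays away from 0 while \<open>h (x n j)\<close> tends to 0 for all \<open>j \<noteq> k\<close>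
  (\<open>separating_function_on_subsequence\<close>).  As all masses are bounded by 1, the integrals of \<open>h\<close>
  stay away from 0, which contradicts the choice of the sequence.\<close>

section \<open>Finite additivity and null sets\<close>

lemma signed_measure_empty:
  assumes "signed_measure \<mu>"
  shows "\<mu> {} = 0"
proof -
  have "(\<lambda>n::nat. \<mu> {}) sums \<mu> (\<Union>n::nat. {})"
    using assms[unfolded signed_measure_def, THEN conjunct2, rule_format, of "\<lambda>_. {}"]
    by (simp add: disjoint_family_on_def)
  then show ?thesis
    using sums_summable summable_const_iff by blast
qed

lemma signed_measure_Un:
  assumes \<mu>: "signed_measure \<mu>" and "A \<in> sets borel" "B \<in> sets borel" "A \<inter> B = {}"
  shows "\<mu> (A \<union> B) = \<mu> A + \<mu> B"
proof -
  have "disjoint_family (binaryset A B)"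
    using assms(4) by (auto simp: disjoint_family_on_def binaryset_def)
  moreover have "range (binaryset A B) \<subseteq> sets borel"
    using assms(2,3) by (auto simp: range_binaryset_eq)
  ultimately have "(\<lambda>n. \<mu> (binaryset A B n)) sums \<mu> (\<Union>n. binaryset A B n)"
    using \<mu> unfolding signed_measure_def by blast
  moreover have "(\<lambda>n. \<mu> (binaryset A B n)) sums (\<mu> A + \<mu> B)"
    by (rule binaryset_sums) (rule signed_measure_empty[OF \<mu>])
  ultimately show ?thesis
    by (simp add: UN_binaryset_eq sums_unique2)
qed

lemma finite_imp_borel: "finite A \<Longrightarrow> A \<in> sets (borel :: 'a::t2_space measure)"
  by (intro borel_closed finite_imp_closed)

lemma signed_measure_finite_set:
  fixes \<mu> :: "'a::t2_space set \<Rightarrow> real"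
  assumes \<mu>: "signed_measure \<mu>" and "finite F"
  shows "\<mu> F = (\<Sum>x\<in>F. \<mu> {x})"
  using \<open>finite F\<close>
proof (induction F rule: finite_induct)
  case empty
  show ?case using signed_measure_empty[OF \<mu>] by simp
next
  case (insert x F)
  have "\<mu> ({x} \<union> F) = \<mu> {x} + \<mu> F"
    using insert.hyps by (intro signed_measure_Un[OF \<mu>]) (auto intro: finite_imp_borel)
  then show ?case using insert by simp
qed

lemma abs_le_variation:
  assumes "A \<in> sets borel" "B \<in> sets borel" "B \<subseteq> A" and "signed_measure \<mu>"
  shows "ennreal \<bar>\<mu> B\<bar> \<le> variation \<mu> A"
proof (cases "B = {}")
  case True
  then show ?thesis using signed_measure_empty[OF assms(4)] by simp
next
  case False
  let ?P = "{B, A - B} - {{}}"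
  have "partition_on A ?P"
    using assms False by (auto simp: partition_on_def disjoint_def)
  then have "(\<Sum>C\<in>?P. ennreal \<bar>\<mu> C\<bar>) \<le> variation \<mu> A"
    unfolding variation_def using assms by (intro SUP_upper) auto
  moreover have "ennreal \<bar>\<mu> B\<bar> \<le> (\<Sum>C\<in>?P. ennreal \<bar>\<mu> C\<bar>)"
    using False by (intro member_le_sum) auto
  ultimately show ?thesis by (rule order_trans[rotated])
qed

text \<open>Null sets of the variation are easier to handle through the values of the measure itself: in
  this form their closure under finite unions is just finite additivity.\<close>

lemma variation_zero_iff:
  assumes "signed_measure \<mu>" "A \<in> sets borel"
  shows "variation \<mu> A = 0 \<longleftrightarrow> (\<forall>B \<in> sets borel. B \<subseteq> A \<longrightarrow> \<mu> B = 0)"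
proof
  assume "variation \<mu> A = 0"
  then show "\<forall>B \<in> sets borel. B \<subseteq> A \<longrightarrow> \<mu> B = 0"
    using abs_le_variation[OF assms(2) _ _ assms(1)] by (fastforce simp: ennreal_eq_0_iff)
next
  assume null: "\<forall>B \<in> sets borel. B \<subseteq> A \<longrightarrow> \<mu> B = 0"
  have "(\<Sum>B\<in>P. ennreal \<bar>\<mu> B\<bar>) = 0" if "P \<subseteq> sets borel" "partition_on A P" for P
    using that null by (intro sum.neutral ballI) (auto simp: partition_on_def)
  then have "variation \<mu> A \<le> 0"
    unfolding variation_def by (intro SUP_least) auto
  then show "variation \<mu> A = 0" by simp
qed

lemma variation_zero_Un:
  assumes \<mu>: "signed_measure \<mu>" and "A \<in> sets borel" "B \<in> sets borel"
    and "variation \<mu> A = 0" "variation \<mu> B = 0"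
  shows "variation \<mu> (A \<union> B) = 0"
proof -
  have null: "\<forall>C\<in>sets borel. C \<subseteq> A \<longrightarrow> \<mu> C = 0" "\<forall>C\<in>sets borel. C \<subseteq> B \<longrightarrow> \<mu> C = 0"
    using assms(4,5) variation_zero_iff[OF \<mu> assms(2)] variation_zero_iff[OF \<mu> assms(3)] by blast+
  have "\<mu> C = 0" if "C \<in> sets borel" "C \<subseteq> A \<union> B" for C
  proof -
    have C: "C \<inter> A \<in> sets borel" "C - A \<in> sets borel" "C - A \<subseteq> B"
      using that assms(2) by auto
    have "\<mu> C = \<mu> ((C \<inter> A) \<union> (C - A))" by (simp add: Int_Diff_Un)
    also have "\<dots> = \<mu> (C \<inter> A) + \<mu> (C - A)"
      by (rule signed_measure_Un[OF \<mu> C(1,2)]) blast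
    also have "\<dots> = 0" using null C by simp
    finally show ?thesis .
  qed
  then show ?thesis
    using variation_zero_iff[OF \<mu>, of "A \<union> B"] assms(2,3) by blast
qed

lemma variation_zero_finite_Union:
  assumes \<mu>: "signed_measure \<mu>" and "finite \<U>"
    and "\<And>U. U \<in> \<U> \<Longrightarrow> open U \<and> variation \<mu> U = 0"
  shows "variation \<mu> (\<Union>\<U>) = 0"
  using assms(2,3)
proof (induction \<U> rule: finite_induct)
  case empty
  then show ?case using signed_measure_empty[OF \<mu>] by (simp add: variation_zero_iff[OF \<mu>])
next
  case (insert U \<U>)
  then show ?case
    using variation_zero_Un[OF \<mu>, of U "\<Union>\<U>"] by (auto intro: borel_open open_Union)
qed

section \<open>Measures with finitely many atoms\<close>

text \<open>The value 0 outside the Borel sets is the one that \<^const>\<open>signed_measure\<close> prescribes, so that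
  a signed measure can be equal to an atomic one as a function.\<close>

definition atomic_measure :: "'a::t2_space set \<Rightarrow> ('a \<Rightarrow> real) \<Rightarrow> 'a set \<Rightarrow> real" where
  "atomic_measure S c A = (if A \<in> sets borel then \<Sum>x\<in>S \<inter> A. c x else 0)"

lemma signed_measure_atomic:
  assumes "finite S"
  shows "signed_measure (atomic_measure S c)"
  unfolding signed_measure_def
proof (intro conjI allI impI)
  fix A :: "'a set"
  assume "A \<notin> sets borel"
  then show "atomic_measure S c A = 0" by (simp add: atomic_measure_def)
next
  fix A :: "nat \<Rightarrow> 'a set"
  assume A: "range A \<subseteq> sets borel" "disjoint_family A"
  \<comment> \<open>A finite sum of multiples of point evaluations, each of which is \<open>\<sigma>\<close>-additive.\<close>
  have val: "atomic_measure S c B = (\<Sum>x\<in>S. c x * indicator B x)" if "B \<in> sets borel" for B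
    using that assms
    by (auto simp: atomic_measure_def sum.inter_restrict indicator_def intro!: sum.cong)
  have "(\<lambda>n. \<Sum>x\<in>S. c x * indicator (A n) x) sums (\<Sum>x\<in>S. c x * indicator (\<Union>n. A n) x)"
    using A(2) by (intro sums_sum sums_mult indicator_sums) (auto simp: disjoint_family_on_def)
  moreover have "(\<Union>n. A n) \<in> sets borel" using A(1) by auto
  ultimately show "(\<lambda>n. atomic_measure S c (A n)) sums atomic_measure S c (\<Union>n. A n)"
    using A(1) by (auto simp: val range_subsetD)
qed

text \<open>The triangle inequality bounds every partition sum by the sum of the absolute masses, and the
  partition of \<open>A\<close> into its atoms and the remaining massless set attains this bound.\<close>

lemma variation_atomic:
  assumes "finite S" "A \<in> sets borel"
  shows "variation (atomic_measure S c) A = ennreal (\<Sum>x\<in>S \<inter> A. \<bar>c x\<bar>)"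
proof (rule antisym)
  show "variation (atomic_measure S c) A \<le> ennreal (\<Sum>x\<in>S \<inter> A. \<bar>c x\<bar>)"
    unfolding variation_def
  proof (intro SUP_least)
    fix P assume "P \<in> {P. finite P \<and> P \<subseteq> sets borel \<and> partition_on A P}"
    then have P: "finite P" "P \<subseteq> sets borel" "\<Union>P = A" "disjoint P"
      by (auto simp: partition_on_def)
    have "(\<Sum>B\<in>P. \<bar>atomic_measure S c B\<bar>) \<le> (\<Sum>B\<in>P. \<Sum>x\<in>S \<inter> B. \<bar>c x\<bar>)"
      using P(2) by (intro sum_mono) (auto simp: atomic_measure_def)
    also have "\<dots> = (\<Sum>x\<in>(\<Union>B\<in>P. S \<inter> B). \<bar>c x\<bar>)"
      using P assms(1) by (intro sum.UNION_disjoint[symmetric]) (auto simp: disjoint_def)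
    also have "(\<Union>B\<in>P. S \<inter> B) = S \<inter> A" using P(3) by auto
    finally show "(\<Sum>B\<in>P. ennreal \<bar>atomic_measure S c B\<bar>) \<le> ennreal (\<Sum>x\<in>S \<inter> A. \<bar>c x\<bar>)"
      by (simp add: sum_ennreal ennreal_leI)
  qed
next
  let ?Q = "(\<lambda>x. {x}) ` (S \<inter> A)"
  let ?P = "?Q \<union> ({A - S} - {{}})"
  have "partition_on A ?P"
    by (auto simp: partition_on_def disjoint_def)
  moreover have "?P \<subseteq> sets borel"
    using assms by (auto intro: finite_imp_borel)
  ultimately have upper: "(\<Sum>B\<in>?P. ennreal \<bar>atomic_measure S c B\<bar>) \<le> variation (atomic_measure S c) A"
    unfolding variation_def using assms by (intro SUP_upper) auto
  have mono: "(\<Sum>B\<in>?Q. ennreal \<bar>atomic_measure S c B\<bar>)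
      \<le> (\<Sum>B\<in>?P. ennreal \<bar>atomic_measure S c B\<bar>)"
    using assms by (intro sum_mono2) auto
  have "(\<Sum>B\<in>?Q. ennreal \<bar>atomic_measure S c B\<bar>) = ennreal (\<Sum>x\<in>S \<inter> A. \<bar>c x\<bar>)"
  proof -
    have "S \<inter> {x} = {x}" if "x \<in> S \<inter> A" for x using that by auto
    then have "(\<Sum>B\<in>?Q. ennreal \<bar>atomic_measure S c B\<bar>) = (\<Sum>x\<in>S \<inter> A. ennreal \<bar>c x\<bar>)"
      by (subst sum.reindex) (auto simp: atomic_measure_def finite_imp_borel intro!: sum.cong)
    then show ?thesis by simp
  qed
  with order_trans[OF mono upper]
  show "ennreal (\<Sum>x\<in>S \<inter> A. \<bar>c x\<bar>) \<le> variation (atomic_measure S c) A"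
    by simp
qed

text \<open>The variation of \<open>A\<close> is already that of the finite, hence compact, set \<open>S \<inter> A\<close>.\<close>

lemma radon_measure_atomic:
  assumes "finite S"
  shows "radon_measure (atomic_measure S c)"
  unfolding radon_measure_def
proof (intro conjI ballI antisym)
  show "signed_measure (atomic_measure S c)" by (rule signed_measure_atomic[OF assms])
next
  fix A :: "'a set" assume A: "A \<in> sets borel"
  have "variation (atomic_measure S c) A = variation (atomic_measure S c) (S \<inter> A)"
    using assms A by (simp add: variation_atomic finite_imp_borel)
  also have "\<dots> \<le> (SUP C \<in> {C. compact C \<and> C \<subseteq> A}. variation (atomic_measure S c) C)"
    using assms by (intro SUP_upper) (auto intro: finite_imp_compact)
  finally show "variation (atomic_measure S c) A
      \<le> (SUP C \<in> {C. compact C \<and> C \<subseteq> A}. variation (atomic_measure S c) C)" .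
next
  fix A :: "'a set" assume A: "A \<in> sets borel"
  show "(SUP C \<in> {C. compact C \<and> C \<subseteq> A}. variation (atomic_measure S c) C)
      \<le> variation (atomic_measure S c) A"
  proof (intro SUP_least)
    fix C :: "'a set" assume "C \<in> {C. compact C \<and> C \<subseteq> A}"
    then have "C \<in> sets borel" "C \<subseteq> A" by (auto intro: borel_compact)
    then show "variation (atomic_measure S c) C \<le> variation (atomic_measure S c) A"
      using assms A by (auto simp: variation_atomic intro!: ennreal_leI sum_mono2)
  qed
qed

lemma supp_atomic_subset:
  assumes "finite S"
  shows "supp (atomic_measure S c) \<subseteq> S"
proof
  fix x assume x: "x \<in> supp (atomic_measure S c)"
  have "open (- S)" using assms by (simp add: finite_imp_closed open_Compl)
  moreover from this have "variation (atomic_measure S c) (- S) = 0"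
    using assms by (simp add: variation_atomic borel_open)
  ultimately show "x \<in> S" using x by (auto simp: supp_def)
qed

text \<open>The supremum that defines the positive part is attained at the set of atoms of nonnegative
  mass.  Negative masses vanish under \<^const>\<open>ennreal\<close>, so the positive part is a
  \<^const>\<open>point_measure\<close>, pushed forward to the Borel \<open>\<sigma>\<close>-algebra.\<close>

lemma positive_part_atomic:
  assumes "finite S"
  shows "positive_part (atomic_measure S c)
    = distr (point_measure S (\<lambda>x. ennreal (c x))) borel (\<lambda>x. x)" (is "_ = ?N")
proof -
  have eq: "(SUP B \<in> {B \<in> sets borel. B \<subseteq> A}. ennreal (atomic_measure S c B)) = emeasure ?N A"
    if A: "A \<in> sets borel" for A
  proof -
    have N: "emeasure ?N A = (\<Sum>x\<in>S \<inter> A. ennreal (c x))"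
      using assms A
      by (subst emeasure_distr) (auto simp: measurable_def space_point_measure sets_point_measure
          emeasure_point_measure_finite vimage_def intro!: sum.cong)
    show ?thesis
      unfolding N
    proof (intro antisym SUP_least)
      fix B assume "B \<in> {B \<in> sets borel. B \<subseteq> A}"
      then have B: "B \<in> sets borel" "B \<subseteq> A" by auto
      have "ennreal (atomic_measure S c B) \<le> ennreal (\<Sum>x\<in>S \<inter> B. max 0 (c x))"
        using B by (auto simp: atomic_measure_def intro!: ennreal_leI sum_mono)
      also have "\<dots> = (\<Sum>x\<in>S \<inter> B. ennreal (c x))"
        by (subst sum_ennreal[symmetric]) auto
      also have "\<dots> \<le> (\<Sum>x\<in>S \<inter> A. ennreal (c x))"
        using assms B by (intro sum_mono2) auto
      finally show "ennreal (atomic_measure S c B) \<le> (\<Sum>x\<in>S \<inter> A. ennreal (c x))" .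
    next
      let ?B = "{x \<in> S \<inter> A. c x \<ge> 0}"
      have "(\<Sum>x\<in>S \<inter> A. ennreal (c x)) = (\<Sum>x\<in>?B. ennreal (c x))"
        using assms by (intro sum.mono_neutral_right) (auto simp: ennreal_eq_0_iff)
      also have "\<dots> = ennreal (\<Sum>x\<in>?B. c x)"
        by (rule sum_ennreal) simp
      also have "(\<Sum>x\<in>?B. c x) = atomic_measure S c ?B"
        using assms by (auto simp: atomic_measure_def finite_imp_borel intro!: sum.cong)
      also have "ennreal \<dots>
          \<le> (SUP B \<in> {B \<in> sets borel. B \<subseteq> A}. ennreal (atomic_measure S c B))"
        using assms by (intro SUP_upper) (auto intro: finite_imp_borel)
      finally show "(\<Sum>x\<in>S \<inter> A. ennreal (c x))
          \<le> (SUP B \<in> {B \<in> sets borel. B \<subseteq> A}. ennreal (atomic_measure S c B))" .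
    qed
  qed
  have "positive_part (atomic_measure S c) = measure_of UNIV (sets borel) (emeasure ?N)"
    unfolding positive_part_def
    by (rule measure_of_eq)
      (use eq sets.sigma_sets_eq[of "borel :: 'a measure"] in \<open>simp_all\<close>)
  also have "\<dots> = ?N"
    using measure_of_of_measure[of ?N] by simp
  finally show ?thesis .
qed

lemma integral_positive_part_atomic:
  fixes f :: "'a::t2_space \<Rightarrow> real"
  assumes "finite S" and "f \<in> borel_measurable borel"
  shows "integral\<^sup>L (positive_part (atomic_measure S c)) f = (\<Sum>x\<in>S. max 0 (c x) * f x)"
proof -
  have "point_measure S (\<lambda>x. ennreal (c x)) = point_measure S (\<lambda>x. ennreal (max 0 (c x)))"
    by simp
  then have "integral\<^sup>L (positive_part (atomic_measure S c)) f
      = integral\<^sup>L (point_measure S (\<lambda>x. ennreal (max 0 (c x)))) f"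
    using assms by (simp add: positive_part_atomic integral_distr measurable_def
        space_point_measure sets_point_measure del: ennreal_max_0')
  also have "\<dots> = (\<Sum>x\<in>S. max 0 (c x) * f x)"
    using assms by (subst lebesgue_integral_point_measure_finite) auto
  finally show ?thesis .
qed

text \<open>Positive and negative part carry the masses \<open>max 0 (c x)\<close> and \<open>max 0 (- c x)\<close>, whose
  difference is \<open>c x\<close>.\<close>

lemma signed_integral_atomic:
  fixes f :: "'a::t2_space \<Rightarrow> real"
  assumes "finite S" and f: "continuous_on UNIV f"
  shows "signed_integral (atomic_measure S c) f = (\<Sum>x\<in>S. c x * f x)"
proof -
  have m: "f \<in> borel_measurable borel"
    using f by (rule borel_measurable_continuous_onI)
  have neg: "(\<lambda>A. - atomic_measure S c A) = atomic_measure S (\<lambda>x. - c x)"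
    by (auto simp: atomic_measure_def fun_eq_iff sum_negf)
  show ?thesis
    unfolding signed_integral_def negative_part_def neg
    by (auto simp: integral_positive_part_atomic[OF assms(1) m] sum_subtractf[symmetric]
        left_diff_distrib[symmetric] intro!: sum.cong)
qed

text \<open>Here inner regularity is what matters: every point outside the support has a null open
  neighbourhood, so a compact set that misses the support is covered by finitely many of them and
  is null.  By regularity the whole complement of the support is null, and finite additivity
  leaves only the atoms in the support.\<close>

lemma radon_measure_finite_supp_atomic:
  assumes "radon_measure \<mu>" and fin: "finite (supp \<mu>)"
  shows "\<mu> = atomic_measure (supp \<mu>) (\<lambda>x. \<mu> {x})"
proof
  fix A :: "'a set"
  let ?S = "supp \<mu>"
  from assms(1) have \<mu>: "signed_measure \<mu>"
    and radon: "\<And>A. A \<in> sets borel \<Longrightarrow>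
      variation \<mu> A = (SUP C \<in> {C. compact C \<and> C \<subseteq> A}. variation \<mu> C)"
    by (auto simp: radon_measure_def)
  have S: "- ?S \<in> sets borel"
    using fin by (intro borel_open open_Compl finite_imp_closed)
  have "variation \<mu> C = 0" if C: "compact C" "C \<subseteq> - ?S" for C
  proof -
    let ?\<U> = "{U. open U \<and> variation \<mu> U = 0}"
    have "C \<subseteq> \<Union>?\<U>" using C(2) by (auto simp: supp_def)
    then obtain \<U> where \<U>: "\<U> \<subseteq> ?\<U>" "finite \<U>" "C \<subseteq> \<Union>\<U>"
      using compactE[OF C(1), of ?\<U>] by blast
    then have "variation \<mu> (\<Union>\<U>) = 0"
      by (intro variation_zero_finite_Union[OF \<mu>]) auto
    moreover have "\<Union>\<U> \<in> sets borel" using \<U>(1) by (intro borel_open open_Union) auto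
    ultimately show ?thesis
      using \<U>(3) borel_compact[OF C(1)] by (auto simp: variation_zero_iff[OF \<mu>])
  qed
  then have "variation \<mu> (- ?S) \<le> 0"
    unfolding radon[OF S] by (intro SUP_least) auto
  then have null: "\<And>B. B \<in> sets borel \<Longrightarrow> B \<subseteq> - ?S \<Longrightarrow> \<mu> B = 0"
    using variation_zero_iff[OF \<mu> S] by auto
  show "\<mu> A = atomic_measure ?S (\<lambda>x. \<mu> {x}) A"
  proof (cases "A \<in> sets borel")
    case True
    have "\<mu> A = \<mu> ((?S \<inter> A) \<union> (A - ?S))" by (rule arg_cong[of _ _ \<mu>]) auto
    also have "\<dots> = \<mu> (?S \<inter> A) + \<mu> (A - ?S)"
      using True fin by (intro signed_measure_Un[OF \<mu>]) (auto intro: finite_imp_borel)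
    also have "\<mu> (A - ?S) = 0"
      using True fin by (intro null) (auto intro: finite_imp_borel)
    also have "\<mu> (?S \<inter> A) = (\<Sum>x\<in>?S \<inter> A. \<mu> {x})"
      using fin by (intro signed_measure_finite_set[OF \<mu>]) auto
    finally show ?thesis using True by (simp add: atomic_measure_def)
  next
    case False
    then show ?thesis using \<mu> by (simp add: signed_measure_def atomic_measure_def)
  qed
qed

lemma half_dirac_difference_atomic:
  assumes "x \<noteq> y"
  shows "(\<lambda>A. 1 / 2 * (dirac x A - dirac y A))
    = atomic_measure {x, y} (\<lambda>z. if z = x then 1 / 2 else - 1 / 2)"
proof
  fix A :: "'a set"
  have "{x, y} \<inter> A = (if x \<in> A then {x} else {}) \<union> (if y \<in> A then {y} else {})" by auto
  then show "1 / 2 * (dirac x A - dirac y A)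
      = atomic_measure {x, y} (\<lambda>z. if z = x then 1 / 2 else - 1 / 2) A"
    using assms
    by (cases "A \<in> sets borel")
      (auto simp: dirac_def atomic_measure_def measure_return measure_notin_sets split: if_splits)
qed

section \<open>Merging and separating sequences of points\<close>

lemma not_tendsto_zero_subsequence:
  fixes a :: "nat \<Rightarrow> real"
  assumes "\<not> a \<longlonglongrightarrow> 0"
  shows "\<exists>s d. strict_mono (s :: nat \<Rightarrow> nat) \<and> d > 0 \<and> (\<forall>n. d \<le> \<bar>a (s n)\<bar>)"
proof -
  obtain d where d: "d > 0" "\<not> (\<forall>\<^sub>F n in sequentially. \<bar>a n\<bar> < d)"
    using assms by (auto simp: tendsto_iff dist_real_def)
  let ?N = "{n. d \<le> \<bar>a n\<bar>}"
  have "\<exists>\<^sub>F n in cofinite. d \<le> \<bar>a n\<bar>"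
    using d(2) by (simp add: frequently_def cofinite_eq_sequentially not_le)
  then have "infinite ?N" by (simp add: frequently_cofinite)
  then have "strict_mono (enumerate ?N)" "\<forall>n. d \<le> \<bar>a (enumerate ?N n)\<bar>"
    using enumerate_in_set[of ?N] by (auto intro: strict_mono_enumerate)
  with d(1) show ?thesis by blast
qed

text \<open>The hypothesis says that no \<open>x _ j\<close> with \<open>j \<in> J\<close> merges with \<open>y\<close> along any subsequence.
  In the induction step \<open>f\<close> keeps \<open>y\<close> and \<open>x _ j\<close> at distance at least \<open>d\<close> on a subsequence.  As \<open>f\<close>
  is bounded, \<open>f (x _ j)\<close> may be assumed to converge, say to \<open>c\<close>.  Then the factor \<open>f - c\<close> tends
  to 0 at \<open>x _ j\<close>, is at least \<open>d / 2\<close> in absolute value at \<open>y\<close>, and is bounded, so that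
  multiplying by it preserves what \<open>h\<close> has already achieved for the other indices.\<close>

lemma separating_function_on_subsequence:
  fixes x :: "nat \<Rightarrow> 'i \<Rightarrow> 'a::topological_space" and y :: "nat \<Rightarrow> 'a"
  assumes K: "compact (UNIV :: 'a set)" and "finite J"
    and "\<And>j r. j \<in> J \<Longrightarrow> strict_mono r \<Longrightarrow>
      \<exists>f :: 'a \<Rightarrow> real. continuous_on UNIV f \<and> \<not> (\<lambda>n. f (y (r n)) - f (x (r n) j)) \<longlonglongrightarrow> 0"
  shows "\<exists>(r :: nat \<Rightarrow> nat) (h :: 'a \<Rightarrow> real) e. strict_mono r \<and> continuous_on UNIV h \<and> e > 0 \<and>
    (\<forall>\<^sub>F n in sequentially. e \<le> \<bar>h (y (r n))\<bar>) \<and> (\<forall>j\<in>J. (\<lambda>n. h (x (r n) j)) \<longlonglongrightarrow> 0)"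
  using assms(2,3)
proof (induction J rule: finite_induct)
  case empty
  show ?case
    by (rule exI[of _ id], rule exI[of _ "\<lambda>_. 1"], rule exI[of _ 1]) (auto simp: strict_mono_def)
next
  case (insert j J)
  have bounded: "\<exists>B. \<forall>z. \<bar>f z\<bar> \<le> B" if "continuous_on UNIV f" for f :: "'a \<Rightarrow> real"
    using compact_imp_bounded[OF compact_continuous_image[OF that K]]
    by (auto simp: bounded_iff)
  have "\<exists>(r :: nat \<Rightarrow> nat) (h :: 'a \<Rightarrow> real) e. strict_mono r \<and> continuous_on UNIV h \<and> e > 0 \<and>
      (\<forall>\<^sub>F n in sequentially. e \<le> \<bar>h (y (r n))\<bar>) \<and> (\<forall>j\<in>J. (\<lambda>n. h (x (r n) j)) \<longlonglongrightarrow> 0)"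
    by (rule insert.IH) (rule insert.prems, auto)
  then obtain r :: "nat \<Rightarrow> nat" and h :: "'a \<Rightarrow> real" and e
    where r: "strict_mono r" and h: "continuous_on UNIV h" and e: "e > 0"
    and hy: "\<forall>\<^sub>F n in sequentially. e \<le> \<bar>h (y (r n))\<bar>"
    and hx: "\<forall>i\<in>J. (\<lambda>n. h (x (r n) i)) \<longlonglongrightarrow> 0"
    by blast
  obtain f :: "'a \<Rightarrow> real" where f: "continuous_on UNIV f"
    and nconv: "\<not> (\<lambda>n. f (y (r n)) - f (x (r n) j)) \<longlonglongrightarrow> 0"
    using insert.prems[OF _ r, of j] by auto
  obtain s d where s: "strict_mono (s :: nat \<Rightarrow> nat)" and d: "d > 0"
    and sep: "\<And>n. d \<le> \<bar>f (y (r (s n))) - f (x (r (s n)) j)\<bar>"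
    using not_tendsto_zero_subsequence[OF nconv] by auto
  obtain B where B: "\<And>z. \<bar>f z\<bar> \<le> B" using bounded[OF f] by auto
  obtain C where C: "\<And>z. \<bar>h z\<bar> \<le> C" using bounded[OF h] by auto
  have "bounded (range (\<lambda>n. f (x (r (s n)) j)))"
    using B by (auto simp: bounded_iff)
  from bounded_imp_convergent_subsequence[OF this]
  obtain c and t :: "nat \<Rightarrow> nat" where t: "strict_mono t"
    and conv: "(\<lambda>n. f (x (r (s (t n))) j)) \<longlonglongrightarrow> c"
    unfolding o_def by blast
  define q where "q = r \<circ> s \<circ> t"
  have st: "filterlim (\<lambda>n. s (t n)) sequentially sequentially"
    using filterlim_subseq[OF strict_mono_o[OF s t]] by (simp add: o_def)
  have q: "strict_mono q"
    unfolding q_def by (intro strict_mono_o r s t)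
  let ?g = "\<lambda>z. h z * (f z - c)"
  have "\<forall>\<^sub>F n in sequentially. \<bar>f (x (q n) j) - c\<bar> < d / 2"
    using tendstoD[OF conv, of "d / 2"] d by (simp add: dist_real_def q_def)
  moreover have "\<forall>\<^sub>F n in sequentially. e \<le> \<bar>h (y (q n))\<bar>"
    using eventually_compose_filterlim[OF hy st] by (simp add: q_def)
  ultimately have "\<forall>\<^sub>F n in sequentially. e * (d / 2) \<le> \<bar>?g (y (q n))\<bar>"
  proof eventually_elim
    case (elim n)
    have "d \<le> \<bar>f (y (q n)) - f (x (q n) j)\<bar>" using sep[of "t n"] by (simp add: q_def)
    with elim(1) have "d / 2 \<le> \<bar>f (y (q n)) - c\<bar>" by linarith
    with elim(2) show ?case
      unfolding abs_mult using d by (intro mult_mono) auto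
  qed
  moreover have "(\<lambda>n. ?g (x (q n) i)) \<longlonglongrightarrow> 0" if "i \<in> insert j J" for i
  proof (cases "i = j")
    case True
    have "(\<lambda>n. f (x (q n) j) - c) \<longlonglongrightarrow> 0"
      using tendsto_diff[OF conv tendsto_const[of c]] by (simp add: q_def)
    then show ?thesis
      unfolding True using C
      by (intro lim_null_mult_left_bounded[where B = C]) auto
  next
    case False
    then have "(\<lambda>n. h (x (q n) i)) \<longlonglongrightarrow> 0"
      using filterlim_compose[OF hx[rule_format] st, of i] that by (simp add: q_def)
    moreover have "\<bar>f z - c\<bar> \<le> B + \<bar>c\<bar>" for z
      using B[of z] by linarith
    ultimately show ?thesis
      by (intro lim_null_mult_right_bounded[where B = "B + \<bar>c\<bar>"]) auto
  qed
  moreover have "continuous_on UNIV ?g" by (intro continuous_intros h f)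
  moreover have "e * (d / 2) > 0" using e d by simp
  ultimately show ?case using q by blast
qed

text \<open>Distinctness of the two points gives norm 1, since the two masses cannot cancel.\<close>

lemma merging_points_fsJN_sequence:
  fixes x y :: "nat \<Rightarrow> 'a::t2_space"
  assumes neq: "\<And>n. x n \<noteq> y n"
    and merge: "\<And>f :: 'a \<Rightarrow> real. continuous_on UNIV f \<Longrightarrow> (\<lambda>n. f (x n) - f (y n)) \<longlonglongrightarrow> 0"
  shows "fsJN_sequence (\<lambda>n A. 1 / 2 * (dirac (x n) A - dirac (y n) A))"
proof -
  let ?c = "\<lambda>n z. if z = x n then 1 / 2 else - 1 / 2 :: real"
  have atomic: "(\<lambda>n A. 1 / 2 * (dirac (x n) A - dirac (y n) A))
      = (\<lambda>n. atomic_measure {x n, y n} (?c n))"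
    using half_dirac_difference_atomic[OF neq] by auto
  show ?thesis
    unfolding fsJN_sequence_def atomic
  proof (intro conjI allI impI)
    fix n
    show "radon_measure (atomic_measure {x n, y n} (?c n))"
      by (intro radon_measure_atomic) simp
    show "finite (supp (atomic_measure {x n, y n} (?c n)))"
      using supp_atomic_subset[of "{x n, y n}"] by (rule finite_subset) auto
    show "tv_norm (atomic_measure {x n, y n} (?c n)) = 1"
      using neq[of n] by (auto simp: tv_norm_def variation_atomic)
  next
    fix f :: "'a \<Rightarrow> real" assume f: "continuous_on UNIV f"
    have int: "signed_integral (atomic_measure {x n, y n} (?c n)) f = (f (x n) - f (y n)) / 2" for n
      using neq[of n] by (auto simp: signed_integral_atomic f)
    show "(\<lambda>n. signed_integral (atomic_measure {x n, y n} (?c n)) f) \<longlonglongrightarrow> 0"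
      unfolding int using tendsto_divide[OF merge[OF f] tendsto_const[of 2]] by simp
  qed
qed

text \<open>A heavy atom, whose mass stays away from 0 along a subsequence, has to be
  compensated by another atom that merges with it.  Otherwise the function from
  \<open>separating_function_on_subsequence\<close> isolates the heavy atom from all others.\<close>

lemma bounded_supp_imp_merging_points:
  fixes \<mu> :: "nat \<Rightarrow> 'a::t2_space set \<Rightarrow> real"
  assumes K: "compact (UNIV :: 'a set)" and JN: "fsJN_sequence \<mu>"
    and nlim: "\<not> filterlim (\<lambda>n. card (supp (\<mu> n))) at_top sequentially"
  shows "\<exists>x y. (\<forall>n::nat. x n \<noteq> (y n :: 'a)) \<and>
    (\<forall>f :: 'a \<Rightarrow> real. continuous_on UNIV f \<longrightarrow> (\<lambda>n. f (x n) - f (y n)) \<longlonglongrightarrow> 0)"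
proof -
  define S where "S = (\<lambda>n. supp (\<mu> n))"
  define c where "c = (\<lambda>n x. \<mu> n {x})"
  from JN have radon: "\<And>n. radon_measure (\<mu> n)" and fin: "\<And>n. finite (S n)"
    and tv: "\<And>n. tv_norm (\<mu> n) = 1"
    and lim: "\<And>f :: 'a \<Rightarrow> real. continuous_on UNIV f \<Longrightarrow> (\<lambda>n. signed_integral (\<mu> n) f) \<longlonglongrightarrow> 0"
    unfolding fsJN_sequence_def S_def by auto
  have atomic: "\<mu> n = atomic_measure (S n) (c n)" for n
    unfolding S_def c_def
    using radon_measure_finite_supp_atomic[OF radon fin[unfolded S_def]] .
  have mass: "(\<Sum>x\<in>S n. \<bar>c n x\<bar>) = 1" for n
    using tv[of n] fin[of n] by (subst (asm) atomic) (simp add: tv_norm_def variation_atomic)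
  have mass_le: "\<bar>c n x\<bar> \<le> 1" if "x \<in> S n" for n x
    using member_le_sum[OF that, of "\<lambda>x. \<bar>c n x\<bar>"] fin mass by simp
  obtain M where "\<not> (\<forall>\<^sub>F n in sequentially. M \<le> card (S n))"
    using nlim unfolding filterlim_at_top S_def by auto
  then have "\<exists>\<^sub>F n in cofinite. card (S n) < M"
    by (simp add: frequently_def cofinite_eq_sequentially not_less)
  then have inf: "infinite {n. card (S n) < M}" by (simp add: frequently_cofinite)
  have "\<forall>n. \<exists>e. bij_betw e {..<card (S n)} (S n)"
    using ex_bij_betw_nat_finite[OF fin] by (auto simp: atLeast0LessThan)
  then obtain e where e: "\<And>n. bij_betw (e n) {..<card (S n)} (S n)" by metis
  \<comment> \<open>The pigeonhole principle is applied to the pair of the size of the support and the position of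
    an atom of mass at least \<open>1 / M\<close>; such an atom exists since fewer than \<open>M\<close> atoms share the
    total mass 1.\<close>
  let ?heavy = "\<lambda>n (m, k). card (S n) = m \<and> k < m \<and> 1 / real M \<le> \<bar>c n (e n k)\<bar>"
  have "\<exists>b \<in> {..<M} \<times> {..<M}. ?heavy n b" if n: "n \<in> {n. card (S n) < M}" for n
  proof -
    have "\<exists>x\<in>S n. 1 / real M \<le> \<bar>c n x\<bar>"
    proof (rule ccontr)
      assume "\<not> ?thesis"
      then have "(\<Sum>x\<in>S n. \<bar>c n x\<bar>) \<le> real (card (S n)) * (1 / real M)"
        by (intro sum_bounded_above) auto
      also have "\<dots> < 1" using n by (simp add: divide_simps)
      finally show False using mass by simp
    qed
    then obtain k where "k < card (S n)" "1 / real M \<le> \<bar>c n (e n k)\<bar>"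
      using bij_betw_imp_surj_on[OF e[of n]] by force
    then show ?thesis using n by (intro bexI[of _ "(card (S n), k)"]) auto
  qed
  then obtain m k where mk: "infinite {n \<in> {n. card (S n) < M}. ?heavy n (m, k)}"
    using pigeonhole_infinite_rel[OF inf, of "{..<M} \<times> {..<M}" ?heavy] by auto
  define N where "N = {n \<in> {n. card (S n) < M}. ?heavy n (m, k)}"
  define p where "p = enumerate N"
  have p: "strict_mono p" using mk by (simp add: p_def N_def strict_mono_enumerate)
  have pN: "p n \<in> N" for n
    unfolding p_def by (rule enumerate_in_set) (use mk in \<open>simp only: N_def not_False_eq_True\<close>)
  have card: "card (S (p n)) = m" for n using pN[of n] by (simp add: N_def)
  have heavy: "1 / real M \<le> \<bar>c (p n) (e (p n) k)\<bar>" for n using pN[of n] by (simp add: N_def)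
  have k: "k < m" and M: "0 < M" using pN[of 0] by (auto simp: N_def)
  define x where "x = (\<lambda>n. e (p n))"
  have bij: "bij_betw (x n) {..<m} (S (p n))" for n
    using e[of "p n"] by (simp add: x_def card)
  let ?J = "{..<m} - {k}"
  let ?merge = "\<lambda>j r. \<forall>f :: 'a \<Rightarrow> real. continuous_on UNIV f \<longrightarrow>
    (\<lambda>n. f (x (r n) k) - f (x (r n) j)) \<longlonglongrightarrow> 0"
  have "\<exists>j r. j \<in> ?J \<and> strict_mono r \<and> ?merge j r"
  proof (rule ccontr)
    assume contra: "\<not> ?thesis"
    have "\<exists>(r :: nat \<Rightarrow> nat) (h :: 'a \<Rightarrow> real) d. strict_mono r \<and> continuous_on UNIV h \<and> d > 0 \<and>
        (\<forall>\<^sub>F n in sequentially. d \<le> \<bar>h (x (r n) k)\<bar>) \<and>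
        (\<forall>j\<in>?J. (\<lambda>n. h (x (r n) j)) \<longlonglongrightarrow> 0)"
    proof (rule separating_function_on_subsequence[OF K, where y = "\<lambda>n. x n k"])
      fix j and r :: "nat \<Rightarrow> nat"
      assume "j \<in> ?J" "strict_mono r"
      with contra have "\<not> ?merge j r" by blast
      then show "\<exists>f :: 'a \<Rightarrow> real. continuous_on UNIV f \<and>
          \<not> (\<lambda>n. f (x (r n) k) - f (x (r n) j)) \<longlonglongrightarrow> 0" by blast
    qed simp
    then obtain r :: "nat \<Rightarrow> nat" and h :: "'a \<Rightarrow> real" and d
      where r: "strict_mono r" and h: "continuous_on UNIV h"
      and d: "d > 0" and hk: "\<forall>\<^sub>F n in sequentially. d \<le> \<bar>h (x (r n) k)\<bar>"
      and hj: "\<forall>j\<in>?J. (\<lambda>n. h (x (r n) j)) \<longlonglongrightarrow> 0"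
      by blast
    \<comment> \<open>In the integral of \<open>h\<close> only the term of the heavy atom does not vanish in the limit.\<close>
    define a where "a = (\<lambda>n j. c (p (r n)) (x (r n) j))"
    have int: "signed_integral (\<mu> (p (r n))) h = (\<Sum>j<m. a n j * h (x (r n) j))" for n
    proof -
      have "signed_integral (\<mu> (p (r n))) h = (\<Sum>z\<in>S (p (r n)). c (p (r n)) z * h z)"
        by (subst atomic) (rule signed_integral_atomic[OF fin h])
      also have "\<dots> = (\<Sum>j<m. a n j * h (x (r n) j))"
        using sum.reindex_bij_betw[OF bij[of "r n"], of "\<lambda>z. c (p (r n)) z * h z"]
        by (simp add: a_def)
      finally show ?thesis .
    qed
    have "filterlim (\<lambda>n. p (r n)) sequentially sequentially"
      using filterlim_subseq[OF strict_mono_o[OF p r]] by (simp add: o_def)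
    from filterlim_compose[OF lim[OF h] this]
    have "(\<lambda>n. \<Sum>j<m. a n j * h (x (r n) j)) \<longlonglongrightarrow> 0"
      by (simp only: int)
    moreover have "(\<lambda>n. \<Sum>j\<in>?J. a n j * h (x (r n) j)) \<longlonglongrightarrow> 0"
    proof (intro tendsto_null_sum)
      fix j assume j: "j \<in> ?J"
      have "\<bar>a n j\<bar> \<le> 1" for n
        using mass_le bij_betwE[OF bij[of "r n"]] j by (auto simp: a_def)
      then show "(\<lambda>n. a n j * h (x (r n) j)) \<longlonglongrightarrow> 0"
        by (intro lim_null_mult_left_bounded[where B = 1] hj[rule_format] j) auto
    qed
    ultimately have "(\<lambda>n. (\<Sum>j<m. a n j * h (x (r n) j)) - (\<Sum>j\<in>?J. a n j * h (x (r n) j)))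
        \<longlonglongrightarrow> 0 - 0"
      by (rule tendsto_diff)
    then have "(\<lambda>n. a n k * h (x (r n) k)) \<longlonglongrightarrow> 0"
      using k by (simp add: sum.remove[of "{..<m}" k])
    from tendstoD[OF this, of "1 / real M * d"]
    have "\<forall>\<^sub>F n in sequentially. \<bar>a n k * h (x (r n) k)\<bar> < 1 / real M * d"
      using d M by (simp add: dist_real_def)
    then have "\<forall>\<^sub>F n in sequentially. False"
      using hk
    proof eventually_elim
      case (elim n)
      have "1 / real M * d \<le> \<bar>a n k\<bar> * \<bar>h (x (r n) k)\<bar>"
        using elim(2) d heavy[of "r n"] by (intro mult_mono) (auto simp: a_def x_def)
      then show ?case using elim(1) by (simp add: abs_mult)
    qed
    then show False by simp
  qed
  then obtain j r where j: "j < m" "j \<noteq> k" and merge: "?merge j r" by auto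
  have "x (r n) k \<noteq> x (r n) j" for n
    using bij_betw_imp_inj_on[OF bij[of "r n"]] j k by (auto dest: inj_onD)
  with merge show ?thesis by (intro exI[of _ "\<lambda>n. x (r n) k"] exI[of _ "\<lambda>n. x (r n) j"]) auto
qed

theorem theorem5p13:
  assumes "compact (UNIV :: 'a::t2_space set)"
    and "fsJNP TYPE('a)"
  shows "(\<exists>\<mu> :: nat \<Rightarrow> 'a set \<Rightarrow> real. fsJN_sequence \<mu> \<and>
            (\<forall>n. \<exists>x y. \<mu> n = (\<lambda>A. 1 / 2 * (dirac x A - dirac y A)))) \<or>
         (\<forall>\<mu> :: nat \<Rightarrow> 'a set \<Rightarrow> real. fsJN_sequence \<mu> \<longrightarrow>
            filterlim (\<lambda>n. card (supp (\<mu> n))) at_top sequentially)"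
proof (rule disjCI)
  assume "\<not> (\<forall>\<mu> :: nat \<Rightarrow> 'a set \<Rightarrow> real. fsJN_sequence \<mu> \<longrightarrow>
            filterlim (\<lambda>n. card (supp (\<mu> n))) at_top sequentially)"
  then obtain x y :: "nat \<Rightarrow> 'a" where neq: "\<And>n. x n \<noteq> y n"
    and merge: "\<And>f :: 'a \<Rightarrow> real. continuous_on UNIV f \<Longrightarrow> (\<lambda>n. f (x n) - f (y n)) \<longlonglongrightarrow> 0"
    using bounded_supp_imp_merging_points[OF assms(1)] by metis
  from merging_points_fsJN_sequence[OF neq merge]
  show "\<exists>\<mu> :: nat \<Rightarrow> 'a set \<Rightarrow> real. fsJN_sequence \<mu> \<and>
      (\<forall>n. \<exists>x y. \<mu> n = (\<lambda>A. 1 / 2 * (dirac x A - dirac y A)))"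
    by blast
qed

end
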